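(* For all integers $d\ge1$ and $D\ge2d$ and every $\epsilon\in(0,1/1000)$ there is $m_0=m_0(D,\epsilon,d)$ such that for all integers $m\ge m_0$ the following holds. Set $k=\lfloor D/d\rfloor$, let $p$ be the smallest prime greater than $k$, and for $0\le i<k$ let $a_i\in[0,1)$ be the real number with $a_i\equiv i^2/p\pmod 1$. Let $P_1=[m]^d$, $P_2=[2m]^d$, and let $G=(P_1\sqcup P_2,E)$ be the bipartite graph where $x\in P_1$ is adjacent to $y\in P_2$ if an even number of the $kd$ inequalities $$y_j-x_j-\frac{im}{k}-\frac{a_im}{3k}\ge0\qquad\text{for }0\le i<k\text{ and }j\in[d]$$ hold. Then any homogeneous partition of $G$ with error $\epsilon$ must have at least $(D/(32\epsilon d))^d$ parts.
   Context: $[m]=\{1,\dots,m\}$; $P_1$ and $P_2$ are regarded as disjoint vertex classes. Partitions $\Pi_1,\Pi_2$ of $P_1,P_2$ form a homogeneous partition of $G$ with error $\epsilon$ if $\sum\frac{|\pi_1||\pi_2|}{|P_1||P_2|}\le\epsilon$, where the sum is over pairs $(\pi_1,\pi_2)\in\Pi_1\times\Pi_2$ such that $E\cap(\pi_1\times\pi_2)$ is neither all of $\pi_1\times\pi_2$ nor empty. Such a homogeneous partition is said to have at least $K$ parts if $\max\{|\Pi_1|,|\Pi_2|\}\ge K$. *)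

theory Defs
  imports
    "HOL-Analysis.Analysis"
    "HOL-Library.Disjoint_Sets"
    "HOL-Library.FuncSet"
    "HOL-Computational_Algebra.Primes"
begin

text \<open>
  A bipartite graph with finite vertex classes \<open>P1\<close>, \<open>P2\<close> is given by its edge set
  \<open>E \<subseteq> P1 \<times> P2\<close>. An edge is an ordered pair whose first component lies in \<open>P1\<close> and whose
  second component lies in \<open>P2\<close>, so the two classes act as disjoint copies even when
  \<open>P1\<close> and \<open>P2\<close> overlap as sets.
\<close>

definition mixed_pair :: "('a \<times> 'b) set \<Rightarrow> 'a set \<Rightarrow> 'b set \<Rightarrow> bool" where
  "mixed_pair E A B \<longleftrightarrow> E \<inter> (A \<times> B) \<noteq> A \<times> B \<and> E \<inter> (A \<times> B) \<noteq> {}"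

definition homogeneous_partition ::
  "'a set \<Rightarrow> 'b set \<Rightarrow> ('a \<times> 'b) set \<Rightarrow> real \<Rightarrow> 'a set set \<Rightarrow> 'b set set \<Rightarrow> bool" where
  "homogeneous_partition P1 P2 E \<epsilon> \<Pi>1 \<Pi>2 \<longleftrightarrow>
     partition_on P1 \<Pi>1 \<and> partition_on P2 \<Pi>2 \<and>
     (\<Sum>(A, B) \<in> {(A, B). A \<in> \<Pi>1 \<and> B \<in> \<Pi>2 \<and> mixed_pair E A B}.
        (real (card A) * real (card B)) / (real (card P1) * real (card P2))) \<le> \<epsilon>"

definition has_at_least_parts :: "'a set set \<Rightarrow> 'b set set \<Rightarrow> real \<Rightarrow> bool" where
  "has_at_least_parts \<Pi>1 \<Pi>2 K \<longleftrightarrow> real (max (card \<Pi>1) (card \<Pi>2)) \<ge> K"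

text \<open>The points of \<open>[n]\<^sup>d\<close> are functions on \<open>{1..d}\<close>, extended by \<open>undefined\<close> elsewhere.\<close>

definition grid :: "nat \<Rightarrow> nat \<Rightarrow> (nat \<Rightarrow> nat) set" where
  "grid d n = {1..d} \<rightarrow>\<^sub>E {1..n}"

definition next_prime :: "nat \<Rightarrow> nat" where
  "next_prime k = (LEAST p. prime p \<and> k < p)"

definition offset :: "nat \<Rightarrow> nat \<Rightarrow> real" where
  "offset k i = frac (real (i\<^sup>2) / real (next_prime k))"

definition grid_edges :: "nat \<Rightarrow> nat \<Rightarrow> nat \<Rightarrow> ((nat \<Rightarrow> nat) \<times> (nat \<Rightarrow> nat)) set" where
  "grid_edges d k m =
     {(x, y). x \<in> grid d m \<and> y \<in> grid d (2 * m) \<and>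
        even (card {(i, j). i < k \<and> j \<in> {1..d} \<and>
          real (y j) - real (x j) - real i * real m / real k
            - offset k i * real m / (3 * real k) \<ge> 0})}"

end

theory Submission
  imports Defs "HOL-Library.Discrete_Functions"
begin

text \<open>
  If \<open>x\<close> and \<open>x'\<close> lie in the same part \<open>A\<close> of \<open>\<Pi>1\<close>, then every \<open>y\<close> adjacent to exactly one of them
  lies in a part forming a mixed pair with \<open>A\<close>. Hence it suffices to see that many \<open>y\<close> distinguish
  \<open>x\<close> from \<open>x'\<close>: a fraction of at least \<open>min (k \<bar>x\<^sub>j - x'\<^sub>j\<bar> / (2 m)) (1 / 500)\<close> for every
  coordinate \<open>j\<close>. Then a part with mixed fraction \<open>e < 1 / 500\<close> fits into a cube of side
  \<open>2 m e / k\<close>, and convexity bounds the number of parts from below.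

  Freezing all coordinates but one, the claim becomes one about two shifts of a step function whose
  parity changes at its \<open>k\<close> jumps. A jump of one shift that is far from all jumps of the other
  produces both agreement and disagreement. For small shifts all jumps contribute; for large
  ones the offsets \<open>i\<^sup>2 / p\<close> prevent most jumps from being nearly coincident, provided that
  \<open>p = O(k)\<close>. For the latter a Chebyshev estimate is needed: there is a prime in \<open>(n, 4 n]\<close>.
\<close>

section \<open>Primes between n and 4n\<close>

text \<open>The exponent of \<open>p\<close> in an lcm is the maximum of the exponents, hence
  attained by one element; \<open>e > 0\<close> settles the empty lcm, which is 1.\<close>

lemma prime_power_dvd_LcmD:
  fixes p e :: nat
  assumes "finite A" "0 \<notin> A" "prime p" "e > 0" "p ^ e dvd Lcm A"
  shows "\<exists>a\<in>A. p ^ e dvd a"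
  using assms(1,2,5)
proof (induction A rule: finite_induct)
  case empty
  then show ?case using assms(3,4) by simp
next
  case (insert a A)
  have nz: "a \<noteq> 0" "Lcm A \<noteq> 0" using insert by (auto simp: Lcm_0_iff)
  have "p ^ e dvd lcm a (Lcm A)" using insert.prems by simp
  then have "e \<le> max (multiplicity p a) (multiplicity p (Lcm A))"
    using nz assms(3) by (metis lcm_eq_0_iff multiplicity_lcm not_prime_unit power_dvd_iff_le_multiplicity)
  then have "p ^ e dvd a \<or> p ^ e dvd Lcm A"
    by (meson le_max_iff_disj multiplicity_dvd')
  then show ?case using insert by auto
qed

lemma prod_primes_dvd:
  fixes X :: nat
  assumes "finite S" "\<And>p. p \<in> S \<Longrightarrow> prime p \<and> p dvd X"
  shows "\<Prod>S dvd X"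
  using assms
proof (induction S rule: finite_induct)
  case (insert p S)
  have "coprime p (\<Prod>S)"
    using insert by (intro prod_coprime_right) (metis insertCI primes_coprime)
  then show ?case using insert by (simp add: divides_mult)
qed simp

text \<open>Erdos's induction: an even \<open>n > 2\<close> is not prime, and for
  \<open>n = 2 * m + 1\<close> all primes in \<open>(m + 1, n]\<close> divide
  \<open>n choose m\<close>, which is at most \<open>4 ^ m\<close>.\<close>

lemma primorial_le: "\<Prod>{p::nat. prime p \<and> p \<le> n} \<le> 4 ^ n"
proof (induction n rule: less_induct)
  case (less n)
  consider "n < 2" | "n = 2" | "n > 2" "even n" | "n > 2" "odd n" by linarith
  then show ?case
  proof cases
    case 1
    then have "{p::nat. prime p \<and> p \<le> n} = {}" by (auto dest: prime_ge_2_nat)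
    then show ?thesis by (simp only: prod.empty) simp
  next
    case 2
    then have "{p::nat. prime p \<and> p \<le> n} = {2}"
      by (auto intro: antisym dest: prime_ge_2_nat)
    then show ?thesis using 2 by simp
  next
    case 3
    then have "\<not> prime n" using prime_odd_nat by blast
    then have "{p::nat. prime p \<and> p \<le> n} = {p. prime p \<and> p \<le> n - 1}"
      by (auto simp: le_Suc_eq) (metis One_nat_def Suc_pred le_SucE le_imp_less_Suc not_less_eq not_less_zero zero_less_iff_neq_zero)
    also have "\<Prod>\<dots> \<le> 4 ^ (n - 1)" using 3 by (intro less) auto
    also have "\<dots> \<le> 4 ^ n" by (intro power_increasing) auto
    finally show ?thesis .
  next
    case 4
    then obtain m where m: "n = 2 * m + 1" "m \<ge> 1" by (elim oddE) auto
    define S where "S = {p::nat. prime p \<and> m + 1 < p \<and> p \<le> n}"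
    have fin: "finite S" unfolding S_def by simp
    have "{p::nat. prime p \<and> p \<le> n} = {p. prime p \<and> p \<le> m + 1} \<union> S"
      using m by (auto simp: S_def)
    then have "\<Prod>{p::nat. prime p \<and> p \<le> n} = \<Prod>{p. prime p \<and> p \<le> m + 1} * \<Prod>S"
      using fin by (simp only:) (rule prod.union_disjoint, auto simp: S_def)
    moreover have "\<Prod>{p::nat. prime p \<and> p \<le> m + 1} \<le> 4 ^ (m + 1)"
      using m by (intro less) auto
    moreover have "\<Prod>S \<le> 4 ^ m"
    proof -
      have "\<Prod>S dvd (n choose m)"
      proof (rule prod_primes_dvd[OF fin])
        fix p assume p: "p \<in> S"
        have "fact m * fact (n - m) * (n choose m) = (fact n :: nat)"
          using m by (intro binomial_fact_lemma) auto
        moreover have "p dvd (fact n :: nat)" "\<not> p dvd (fact m :: nat)" "\<not> p dvd (fact (n - m) :: nat)"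
          using p m by (simp_all add: S_def prime_dvd_fact_iff del: fact_Suc)
        ultimately show "prime p \<and> p dvd (n choose m)"
          using p by (metis (no_types, lifting) S_def mem_Collect_eq prime_dvd_mult_iff)
      qed
      then have "\<Prod>S \<le> (n choose m)" using m by (intro dvd_imp_le) auto
      \<comment> \<open>The left half of row \<open>2 * m + 1\<close> of Pascal's triangle sums to
        half of \<open>2 ^ (2 * m + 1)\<close>.\<close>
      also have "\<dots> \<le> (\<Sum>k\<le>m. (2 * m + 1 choose k))"
        using m member_le_sum[of m "{..m}" "\<lambda>k. 2 * m + 1 choose k"] by simp
      also have "\<dots> = 4 ^ m" by (simp only: binomial_r_part_sum power_mult) simp
      finally show ?thesis .
    qed
    ultimately have "\<Prod>{p::nat. prime p \<and> p \<le> n} \<le> 4 ^ (m + 1) * 4 ^ m"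
      by (simp only: mult_le_mono)
    then show ?thesis using m by (simp add: power_add mult_2)
  qed
qed

text \<open>Leibniz's harmonic triangle: the entries \<open>1 / ((n + 1) * (n choose j))\<close> satisfy
  \<open>L (n, j + 1) = L (n - 1, j) - L (n, j)\<close>.\<close>

lemma binomial_dvd_Lcm:
  assumes "j \<le> n"
  shows "Suc n * (n choose j) dvd Lcm {1..Suc n}"
proof -
  \<comment> \<open>Divisibility is recast as integrality of a quotient, so that the subtractive
    recurrence applies; induction on \<open>j\<close> then covers the rows \<open>n - 1\<close> and
    \<open>n\<close> at once.\<close>
  have "real (Lcm {1..Suc n}) / real (Suc n * (n choose j)) \<in> \<int>"
    using assms
  proof (induction j arbitrary: n)
    case 0
    have "Suc n dvd Lcm {1..Suc n}" by (intro dvd_Lcm) auto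
    then obtain q where "Lcm {1..Suc n} = Suc n * q" by (elim dvdE)
    then have "real (Lcm {1..Suc n}) = real (Suc n) * real q" by (simp only: of_nat_mult)
    then show ?case by (simp del: of_nat_Suc)
  next
    case (Suc j)
    then obtain n' where n: "n = Suc n'" and j: "j \<le> n'" by (metis Suc_le_D Suc_le_mono)
    have "Lcm {1..n} dvd Lcm {1..Suc n}" by (rule Lcm_subset) auto
    then obtain q where q: "Lcm {1..Suc n} = Lcm {1..n} * q" by (elim dvdE)
    have pos: "real (n choose j) > 0" "real (n' choose j) > 0" "real (n choose Suc j) > 0"
      using Suc.prems j n by (simp_all only: of_nat_0_less_iff zero_less_binomial_iff)
    have a: "real (Suc j) * real (n choose Suc j) = real (n - j) * real (n choose j)"
      by (metis binomial_absorb_comp binomial_absorption mult.commute n of_nat_mult)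
    have b: "real n * real (n' choose j) = real (n - j) * real (n choose j)"
      by (metis binomial_absorb_comp diff_Suc_1 n of_nat_mult)
    have nj: "real (n - j) = real n - real j" "real n > real j" using Suc.prems by auto
    have "1 / real (Suc n * (n choose Suc j))
        = 1 / (real n * real (n' choose j)) - 1 / real (Suc n * (n choose j))"
    proof -
      have "real (n choose Suc j) = real (n - j) * real (n choose j) / real (Suc j)"
        using a by (simp add: field_simps)
      \<comment> \<open>The recurrence with \<open>x = n - j\<close>, \<open>y = j + 1\<close> and
        \<open>c = n choose j\<close>, so that \<open>x + y = n + 1\<close>.\<close>
      moreover have "1 / ((x + y) * (x * c / y)) = 1 / (x * c) - 1 / ((x + y) * c)"
        if "x > 0" "y > 0" "c > 0" for x y c :: real
      proof -
        have "x + y \<noteq> 0" "x \<noteq> 0" "y \<noteq> 0" "c \<noteq> 0" using that by auto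
        then show ?thesis by (simp add: divide_simps)
      qed
      from this[of "real (n - j)" "real (Suc j)" "real (n choose j)"]
      have "1 / (real (Suc n) * (real (n - j) * real (n choose j) / real (Suc j)))
          = 1 / (real (n - j) * real (n choose j)) - 1 / (real (Suc n) * real (n choose j))"
        using pos nj by (simp add: add.commute)
      ultimately show ?thesis by (simp only: b of_nat_mult)
    qed
    then have "real (Lcm {1..Suc n}) / real (Suc n * (n choose Suc j))
       = real q * (real (Lcm {1..n}) / (real n * real (n' choose j)))
         - real (Lcm {1..Suc n}) / real (Suc n * (n choose j))"
      by (metis (no_types, lifting) mult.commute of_nat_mult q right_diff_distrib times_divide_eq_right mult_1_right)
    moreover have "real (Lcm {1..n}) / (real n * real (n' choose j)) \<in> \<int>"
      using Suc.IH[OF j] n by (simp only: of_nat_mult)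
    moreover have "real (Lcm {1..Suc n}) / real (Suc n * (n choose j)) \<in> \<int>"
      using Suc by simp
    ultimately show ?case by (simp only: Ints_diff Ints_mult Ints_of_nat)
  qed
  then obtain z where "real (Lcm {1..Suc n}) / real (Suc n * (n choose j)) = of_int z"
    by (elim Ints_cases)
  moreover have "real (Suc n * (n choose j)) > 0"
    using assms by (simp only: of_nat_0_less_iff) simp
  ultimately have "real (Lcm {1..Suc n}) = of_int z * real (Suc n * (n choose j))"
    by (metis less_irrefl nonzero_divide_eq_eq)
  then have "int (Lcm {1..Suc n}) = z * int (Suc n * (n choose j))"
    by (metis of_int_eq_iff of_int_mult of_int_of_nat_eq)
  then show ?thesis by (metis dvd_triv_right int_dvd_int_iff)
qed

text \<open>The induction can start at 17 because \<open>18 ^ 4 = 104976\<close> and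
  \<open>2 ^ 17 = 131072\<close>; each step multiplies the left side by at most
  \<open>(18 / 17) ^ 4 < 2\<close>.\<close>

lemma Suc_power4_le: "q \<ge> 17 \<Longrightarrow> (q + 1) ^ 4 \<le> (2::nat) ^ q"
proof (induction q rule: dec_induct)
  case (step q)
  have "(q + 2) ^ 4 \<le> 2 * (q + 1) ^ 4"
  proof -
    have "17 * (q + 2) \<le> 18 * (q + 1)" using step by simp
    then have "(17 * (q + 2)) ^ 4 \<le> (18 * (q + 1)) ^ 4" by (rule power_mono) simp
    then have "83521 * (q + 2) ^ 4 \<le> 104976 * (q + 1) ^ 4" by (simp only: power_mult_distrib) simp
    then show ?thesis by linarith
  qed
  then show ?case using step by simp
qed simp

text \<open>Small \<open>n\<close> are covered by the chain 2, 5, 17, 67, 257. For larger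
  \<open>n\<close> the lcm of \<open>{1..4 * n}\<close> is at least \<open>4 ^ (2 * n) / 2\<close>
  by a central binomial coefficient, but without primes in \<open>(n, 4 * n]\<close> it would be
  little more than the primorial of \<open>n\<close>.\<close>

lemma ex_prime_between_n_4n:
  assumes "n \<ge> 1"
  shows "\<exists>p::nat. prime p \<and> n < p \<and> p \<le> 4 * n"
proof (cases "n < 257")
  case True
  consider "n = 1" | "n \<in> {2..4}" | "n \<in> {5..16}" | "n \<in> {17..66}" | "n \<in> {67..256}"
    using True assms by force
  then show ?thesis
  proof cases
    case 1
    then show ?thesis by (intro exI[of _ 2]) auto
  next
    case 2
    then show ?thesis by (intro exI[of _ 5]) auto
  next
    case 3
    then show ?thesis by (intro exI[of _ 17]) auto
  next
    case 4
    then show ?thesis by (intro exI[of _ 67]) auto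
  next
    case 5
    then show ?thesis by (intro exI[of _ 257]) auto
  qed
next
  case False
  show ?thesis
  proof (rule ccontr)
    assume no: "\<not> ?thesis"
    define N where "N = 4 * n"
    define L where "L = Lcm {1..N}"
    define q where "q = floor_sqrt N"
    have L0: "L \<noteq> 0" by (auto simp: L_def Lcm_0_iff)
    have q1: "q * q \<le> N" "N < (q + 1) * (q + 1)"
      using floor_sqrt_power2_le[of N] Suc_floor_sqrt_power2_gt[of N]
      by (auto simp: q_def power2_eq_square)
    have q17: "q \<ge> 17"
    proof (rule ccontr)
      assume "\<not> ?thesis"
      then have "(q + 1) * (q + 1) \<le> 17 * 17" by (intro mult_le_mono) auto
      with q1 False show False by (simp add: N_def)
    qed
    \<comment> \<open>The bound \<open>4 ^ (2 * n) \<le> 4 * n * (N choose (2 * n))\<close> combines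
      with \<open>N choose (2 * n) = 2 * (N - 1 choose (2 * n))\<close> and the divisibility of
      \<open>L\<close> by \<open>N * (N - 1 choose (2 * n))\<close>.\<close>
    have lower: "2 * 4 ^ (2 * n) \<le> 4 * L"
    proof -
      have "real (4 ^ (2 * n)) \<le> 2 * real (2 * n) * real (2 * (2 * n) choose (2 * n))"
        using central_binomial_lower_bound[of "2 * n"] False by (simp add: field_simps)
      then have c: "4 ^ (2 * n) \<le> 4 * n * (N choose (2 * n))"
        unfolding N_def by (metis (mono_tags, lifting) mult.assoc mult_2 numeral_Bit0 numeral_mult numerals(1) of_nat_le_iff of_nat_mult of_nat_numeral mult_numeral_left_semiring_numeral num_double)
      have "N choose (2 * n) = 2 * (N - 1 choose (2 * n))"
        using binomial_absorb_comp[of N "2 * n"] False by (simp add: N_def)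
      moreover have "N * (N - 1 choose (2 * n)) dvd L"
        using binomial_dvd_Lcm[of "2 * n" "N - 1"] False by (simp add: L_def N_def)
      then have "N * (N - 1 choose (2 * n)) \<le> L" using L0 by (intro dvd_imp_le) auto
      ultimately show ?thesis using c by (simp add: N_def)
    qed
    have mult1: "p ^ multiplicity p L \<le> N" "p \<le> n" if "p \<in> prime_factors L" for p
    proof -
      have pr: "prime p" and "multiplicity p L > 0"
        using that by (auto simp: prime_factors_multiplicity)
      then obtain a where a: "a \<in> {1..N}" "p ^ multiplicity p L dvd a"
        using prime_power_dvd_LcmD[of "{1..N}" p "multiplicity p L"] multiplicity_dvd[of p L]
        by (auto simp: L_def)
      then show "p ^ multiplicity p L \<le> N" by (auto dest: dvd_imp_le)
      moreover have "p \<le> p ^ multiplicity p L"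
        using \<open>multiplicity p L > 0\<close> prime_gt_0_nat[OF pr] by (metis dvd_imp_le dvd_power zero_less_power)
      ultimately have "p \<le> 4 * n" by (simp add: N_def)
      with no pr show "p \<le> n" by (meson not_le)
    qed
    \<comment> \<open>Primes up to \<open>q\<close>, the integer square root of \<open>N\<close>,
      number at most \<open>q - 1\<close> and contribute at most \<open>N\<close> each. Primes above
      \<open>q\<close> occur only once, so together they stay below the primorial of
      \<open>n\<close>.\<close>
    define A where "A = {p \<in> prime_factors L. p \<le> q}"
    define B where "B = {p \<in> prime_factors L. q < p}"
    have "L = (\<Prod>p\<in>prime_factors L. p ^ multiplicity p L)"
      using L0 by (simp add: prime_factorization_nat)
    also have "prime_factors L = A \<union> B" by (auto simp: A_def B_def)
    also have "(\<Prod>p\<in>A \<union> B. p ^ multiplicity p L)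
       = (\<Prod>p\<in>A. p ^ multiplicity p L) * (\<Prod>p\<in>B. p ^ multiplicity p L)"
      by (rule prod.union_disjoint) (auto simp: A_def B_def)
    also have "\<dots> \<le> N ^ (q - 1) * 4 ^ n"
    proof (rule mult_le_mono)
      have "(\<Prod>p\<in>A. p ^ multiplicity p L) \<le> (\<Prod>p\<in>A. N)"
        by (rule prod_mono) (auto simp: A_def mult1)
      also have "\<dots> = N ^ card A" by simp
      also have "card A \<le> card {2..q}"
        by (rule card_mono) (auto simp: A_def in_prime_factors_iff prime_ge_2_nat)
      then have "N ^ card A \<le> N ^ (q - 1)"
        using False by (intro power_increasing) (auto simp: N_def)
      finally show "(\<Prod>p\<in>A. p ^ multiplicity p L) \<le> N ^ (q - 1)" .
    next
      have "(\<Prod>p\<in>B. p ^ multiplicity p L) \<le> (\<Prod>p\<in>B. p)"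
      proof (rule prod_mono, safe)
        fix p assume p: "p \<in> B"
        have p1: "q < p" "p \<in> prime_factors L" using p by (auto simp: B_def)
        have "multiplicity p L \<le> 1"
        proof (rule ccontr)
          assume "\<not> ?thesis"
          then have "p ^ 2 \<le> p ^ multiplicity p L"
            using p1 q17 by (intro power_increasing) auto
          also have "\<dots> \<le> N" by (rule mult1[OF p1(2)])
          finally have "p ^ 2 \<le> N" .
          moreover have "(q + 1) * (q + 1) \<le> p * p" using p1 by (intro mult_le_mono) auto
          ultimately show False using q1 by (simp add: power2_eq_square)
        qed
        then show "p ^ multiplicity p L \<le> p"
          using p1 q17 power_increasing[of "multiplicity p L" 1 p] by simp
      qed
      also have "\<dots> \<le> \<Prod>{p::nat. prime p \<and> p \<le> n}"
        by (intro dvd_imp_le prod_dvd_prod_subset prod_pos)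
           (auto simp: B_def mult1 in_prime_factors_iff prime_gt_0_nat)
      also have "\<dots> \<le> 4 ^ n" by (rule primorial_le)
      finally show "(\<Prod>p\<in>B. p ^ multiplicity p L) \<le> 4 ^ n" .
    qed
    finally have "2 * 4 ^ (2 * n) \<le> 4 * (N ^ (q - 1) * 4 ^ n)" using lower by linarith
    moreover have "(4::nat) ^ (2 * n) = 4 ^ n * 4 ^ n" by (simp add: mult_2 power_add)
    ultimately have "(4::nat) ^ n * 4 ^ n \<le> (2 * N ^ (q - 1)) * 4 ^ n" by simp
    then have u: "(4::nat) ^ n \<le> 2 * N ^ (q - 1)" by (simp only: mult_le_cancel2) simp
    \<comment> \<open>Squaring brings in \<open>N ^ 2 \<le> (q + 1) ^ 4 \<le> 2 ^ q\<close>, so the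
      right side becomes \<open>2 ^ (2 + q * (q - 1))\<close>, which is less than
      \<open>2 ^ (q * q) \<le> 2 ^ N\<close>.\<close>
    have "((4::nat) ^ n) ^ 2 \<le> (2 * N ^ (q - 1)) ^ 2" by (rule power_mono[OF u]) simp
    also have "\<dots> = 4 * (N ^ 2) ^ (q - 1)" by (simp add: power_mult_distrib mult.commute flip: power_mult)
    also have "\<dots> \<le> 4 * (2 ^ q) ^ (q - 1)"
    proof -
      have "N ^ 2 \<le> ((q + 1) * (q + 1)) ^ 2" using q1 by (intro power_mono) auto
      also have "\<dots> = (q + 1) ^ 4" by (simp only: power2_eq_square power4_eq_xxxx mult.assoc)
      also have "\<dots> \<le> 2 ^ q" by (rule Suc_power4_le[OF q17])
      finally show ?thesis by (intro mult_le_mono power_mono) auto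
    qed
    also have "\<dots> = 2 ^ (2 + q * (q - 1))" by (simp add: power_add power_mult)
    also have "\<dots> < 2 ^ (q * q)"
    proof (rule power_strict_increasing)
      have "q * q = q * (q - 1) + q" using q17 by (cases q) auto
      then show "2 + q * (q - 1) < q * q" using q17 by simp
    qed simp
    also have "\<dots> \<le> 2 ^ (4 * n)" using q1 by (intro power_increasing) (auto simp: N_def)
    also have "\<dots> = ((4::nat) ^ n) ^ 2"
    proof -
      have "(4::nat) ^ n = 2 ^ (2 * n)" by (simp add: power_mult)
      then show ?thesis by (simp flip: power_mult)
    qed
    finally show False by simp
  qed
qed

section \<open>Shifted step functions in one dimension\<close>

text \<open>The \<open>i\<close>-th inequality in coordinate \<open>j\<close> says that
  \<open>y j - x j\<close> has reached \<open>thr k m i\<close>; these are the jumps of the step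
  function \<open>level\<close>.\<close>

definition thr :: "nat \<Rightarrow> nat \<Rightarrow> nat \<Rightarrow> real" where
  "thr k m i = real i * real m / real k + offset k i * real m / (3 * real k)"

definition level :: "nat \<Rightarrow> nat \<Rightarrow> real \<Rightarrow> nat" where
  "level k m z = card {i. i < k \<and> thr k m i \<le> z}"

lemma offset_bounds: "0 \<le> offset k i" "offset k i < 1"
  by (simp_all add: offset_def frac_ge_0 frac_lt_1)

text \<open>Unperturbed jumps are \<open>m / k\<close> apart, and the offsets move each to the right
  by less than \<open>m / (3 * k)\<close>.\<close>

lemma thr_gap:
  assumes "i < i'" "k > 0"
  shows "thr k m i + 2 * real m / (3 * real k) \<le> thr k m i'"
proof -
  have "real i + 1 \<le> real i'" using assms by simp
  then have "3 * real i + offset k i + 2 \<le> 3 * real i' + offset k i'"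
    using offset_bounds[of k i] offset_bounds[of k i'] by linarith
  then have "(3 * real i + offset k i + 2) * (real m / (3 * real k))
      \<le> (3 * real i' + offset k i') * (real m / (3 * real k))"
    by (intro mult_right_mono) auto
  then show ?thesis using assms by (simp add: thr_def field_simps)
qed

lemma thr_nonneg: "0 \<le> thr k m i"
  by (simp add: thr_def offset_bounds)

lemma thr_upper:
  assumes "i < k"
  shows "thr k m i + 2 * real m / (3 * real k) \<le> real m"
proof -
  have "real i + 1 \<le> real k" using assms by simp
  then have "3 * real i + offset k i + 2 \<le> 3 * real k"
    using offset_bounds[of k i] by linarith
  then have "(3 * real i + offset k i + 2) * (real m / (3 * real k)) \<le> 3 * real k * (real m / (3 * real k))"
    by (intro mult_right_mono) auto
  then show ?thesis using assms by (simp add: thr_def field_simps)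
qed

text \<open>The gap leaves no further jump in this interval. Indices start at 0, so
  \<open>Suc i\<close> jumps have been passed.\<close>

lemma level_eq_Suc:
  assumes "i < k" "thr k m i \<le> z" "z < thr k m i + 2 * real m / (3 * real k)"
  shows "level k m z = Suc i"
proof -
  have "thr k m i' \<le> z \<longleftrightarrow> i' \<le> i" if "i' < k" for i'
  proof (cases i i' rule: linorder_cases)
    case less
    then show ?thesis using assms that thr_gap[of i i' k m] by linarith
  next
    case greater
    moreover have "0 \<le> 2 * real m / (3 * real k)" by simp
    ultimately show ?thesis using assms that thr_gap[of i' i k m] by linarith
  qed (use assms in auto)
  then have "{i'. i' < k \<and> thr k m i' \<le> z} = {..i}" using assms(1) by auto
  then show ?thesis by (simp add: level_def)
qed

lemma level_eq:
  assumes "i < k" "z < thr k m i" "thr k m i \<le> z + 2 * real m / (3 * real k)"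
  shows "level k m z = i"
proof -
  have "thr k m i' \<le> z \<longleftrightarrow> i' < i" if "i' < k" for i'
  proof (cases i i' rule: linorder_cases)
    case less
    moreover have "0 \<le> 2 * real m / (3 * real k)" by simp
    ultimately show ?thesis using assms that thr_gap[of i i' k m] by linarith
  next
    case greater
    then show ?thesis using assms that thr_gap[of i' i k m] by linarith
  qed (use assms in auto)
  then have "{i'. i' < k \<and> thr k m i' \<le> z} = {..<i}" using assms(1) by auto
  then show ?thesis by (simp add: level_def)
qed

lemma level_cong:
  assumes "\<And>i. i < k \<Longrightarrow> thr k m i \<le> z \<longleftrightarrow> thr k m i \<le> z'"
  shows "level k m z = level k m z'"
  unfolding level_def by (rule arg_cong[where f = card]) (use assms in auto)

lemma card_nats_between:
  assumes "0 \<le> a"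
  shows "card {u::nat. a \<le> real u \<and> real u < a + real q} = q"
proof -
  have "{u::nat. a \<le> real u \<and> real u < a + real q} = {nat \<lceil>a\<rceil>..<nat \<lceil>a\<rceil> + q}"
  proof (intro set_eqI)
    fix u :: nat
    have "a \<le> real u \<longleftrightarrow> nat \<lceil>a\<rceil> \<le> u" by (simp add: nat_le_iff ceiling_le_iff)
    moreover have "real u < a + real q \<longleftrightarrow> u < nat \<lceil>a\<rceil> + q"
    proof -
      have "real u < a + real q \<longleftrightarrow> int u - int q < \<lceil>a\<rceil>"
        by (simp add: less_ceiling_iff) linarith
      also have "\<dots> \<longleftrightarrow> u < nat \<lceil>a\<rceil> + q" using assms by linarith
      finally show ?thesis .
    qed
    ultimately show "u \<in> {u. a \<le> real u \<and> real u < a + real q} \<longleftrightarrow> u \<in> {nat \<lceil>a\<rceil>..<nat \<lceil>a\<rceil> + q}"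
      by simp
  qed
  then show ?thesis by simp
qed

text \<open>One-coordinate form of \<open>y\<close> not distinguishing two vertices:
  \<open>u\<close> is a coordinate of \<open>y\<close>, and \<open>x\<close>, \<open>x'\<close> are
  the same coordinate of the two vertices.\<close>

definition agree :: "nat \<Rightarrow> nat \<Rightarrow> nat \<Rightarrow> nat \<Rightarrow> nat \<Rightarrow> bool" where
  "agree k m x x' u \<longleftrightarrow>
     (even (level k m (real u - real x)) \<longleftrightarrow> even (level k m (real u - real x')))"

text \<open>At a jump of the shifted step function at \<open>x'\<close> that stays at distance \<open>q\<close> from every jump
  of the one shifted by \<open>x\<close>, agreement and disagreement are swapped, so that each of them occupies
  one of the two adjacent intervals of length \<open>q\<close>.\<close>

lemma card_agree_ge_isolated:
  assumes "1 \<le> x" "x + q \<le> x'" "x' \<le> m" "3 * k * q \<le> m" "I \<subseteq> {..<k}"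
    and iso: "\<And>i i'. i \<in> I \<Longrightarrow> i' < k \<Longrightarrow>
      real q \<le> \<bar>real x' + thr k m i - real x - thr k m i'\<bar>"
  shows "card I * q \<le> card {u \<in> {1..2 * m}. agree k m x x' u = b}"
proof (cases "I = {}")
  case False
  then have k: "k > 0" using assms(5) by auto
  have fin: "finite I" using assms(5) finite_subset by blast
  define t where "t i = real x' + thr k m i" for i
  \<comment> \<open>The upper end is \<open>t i\<close>, spelled in the form that
    \<open>card_nats_between\<close> expects.\<close>
  define Lo where "Lo i = {u::nat. t i - real q \<le> real u \<and> real u < t i - real q + real q}" for i
  define Hi where "Hi i = {u::nat. t i \<le> real u \<and> real u < t i + real q}" for i
  \<comment> \<open>Thus \<open>q\<close> is at most half the minimal gap, which makes the windows
    around different jumps disjoint.\<close>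
  have q3: "real q \<le> real m / (3 * real k)"
  proof -
    have "real (3 * k * q) \<le> real m" using assms(4) by (simp only: of_nat_le_iff)
    then show ?thesis using k by (simp add: field_simps)
  qed
  then have q2: "real q \<le> 2 * real m / (3 * real k)"
    by (rule order_trans) (simp add: divide_right_mono)
  have xq: "real x + real q \<le> real x'" using assms(2) by (simp flip: of_nat_add)
  have t0: "t i - real q \<ge> real x" for i using xq thr_nonneg[of k m i] by (simp add: t_def)
  have range: "u \<in> {1..2 * m}" if "u \<in> Lo i \<union> Hi i" "i \<in> I" for u i
  proof -
    have "real u \<ge> real x" "real u < t i + real q" using t0[of i] that by (auto simp: Lo_def Hi_def)
    moreover have "t i + real q \<le> real x' + real m"
      using thr_upper[of i k m] q2 assms(5) that(2) by (auto simp: t_def)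
    ultimately show ?thesis using assms(1,3) by auto
  qed
  have const: "level k m (real u - real x) = level k m (real v - real x)"
    if "u \<in> Lo i \<union> Hi i" "v \<in> Lo i \<union> Hi i" "i \<in> I" for u v i
  proof (rule level_cong)
    fix i' assume "i' < k"
    from iso[OF that(3) this]
    consider "real x + thr k m i' \<le> t i - real q" | "real x + thr k m i' \<ge> t i + real q"
      unfolding t_def by linarith
    then show "thr k m i' \<le> real u - real x \<longleftrightarrow> thr k m i' \<le> real v - real x"
      using that(1,2) by cases (auto simp: Lo_def Hi_def)
  qed
  have lo: "level k m (real u - real x') = i" if "u \<in> Lo i" "i \<in> I" for u i
    using that q2 assms(5) by (intro level_eq) (auto simp: Lo_def t_def)
  have hi: "level k m (real u - real x') = Suc i" if "u \<in> Hi i" "i \<in> I" for u i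
    using that q2 assms(5) by (intro level_eq_Suc) (auto simp: Hi_def t_def)
  have "\<exists>S. S \<subseteq> Lo i \<union> Hi i \<and> card S = q \<and> (\<forall>u\<in>S. agree k m x x' u = b)" if "i \<in> I" for i
  proof -
    have c: "card (Lo i) = q" "card (Hi i) = q"
      unfolding Lo_def Hi_def using t0[of i] by (intro card_nats_between; linarith)+
    have opp: "agree k m x x' u \<noteq> agree k m x x' v" if "u \<in> Lo i" "v \<in> Hi i" for u v
      using const[of u i v] lo[of u i] hi[of v i] that \<open>i \<in> I\<close> by (auto simp: agree_def)
    show ?thesis
    \<comment> \<open>Every point of \<open>Lo i\<close> is opposite to every point of
      \<open>Hi i\<close>, so one failure in \<open>Lo i\<close> forces the value \<open>b\<close>
      on all of \<open>Hi i\<close>.\<close>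
    proof (cases "\<forall>u\<in>Lo i. agree k m x x' u = b")
      case True
      then show ?thesis using c by (intro exI[of _ "Lo i"]) auto
    next
      case False
      then obtain u where "u \<in> Lo i" "agree k m x x' u \<noteq> b" by blast
      then have "\<forall>v\<in>Hi i. agree k m x x' v = b" using opp by metis
      then show ?thesis using c by (intro exI[of _ "Hi i"]) auto
    qed
  qed
  then have "\<forall>i\<in>I. \<exists>S. S \<subseteq> Lo i \<union> Hi i \<and> card S = q \<and> (\<forall>u\<in>S. agree k m x x' u = b)"
    by blast
  from bchoice[OF this] obtain S where S: "\<And>i. i \<in> I \<Longrightarrow> S i \<subseteq> Lo i \<union> Hi i"
      "\<And>i. i \<in> I \<Longrightarrow> card (S i) = q" "\<And>i u. i \<in> I \<Longrightarrow> u \<in> S i \<Longrightarrow> agree k m x x' u = b"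
    by blast
  have less: "u < v" if "u \<in> Lo i \<union> Hi i" "v \<in> Lo i' \<union> Hi i'" "i < i'" for u v i i'
  proof -
    have "real u < t i + real q" "t i' - real q \<le> real v"
      using that by (auto simp: Lo_def Hi_def)
    moreover have "t i + 2 * (real m / (3 * real k)) \<le> t i'"
      using thr_gap[OF that(3) k, of m] by (simp add: t_def)
    ultimately show ?thesis using q3 by linarith
  qed
  have "card I * q = (\<Sum>i\<in>I. card (S i))" using S(2) by simp
  also have "\<dots> = card (\<Union>i\<in>I. S i)"
  proof (rule card_UN_disjoint[symmetric])
    show "\<forall>i\<in>I. finite (S i)"
      using S(1) range by (blast intro: finite_subset[of _ "{1..2 * m}"])
    show "\<forall>i\<in>I. \<forall>j\<in>I. i \<noteq> j \<longrightarrow> S i \<inter> S j = {}"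
    proof (intro ballI impI)
      fix i j assume ij: "i \<in> I" "j \<in> I" "i \<noteq> j"
      have False if "u \<in> S i" "u \<in> S j" for u
        using ij less[of u i u j] less[of u j u i] S(1)[of i] S(1)[of j] that
        by (cases i j rule: linorder_cases) auto
      then show "S i \<inter> S j = {}" by blast
    qed
  qed (rule fin)
  also have "\<dots> \<le> card {u \<in> {1..2 * m}. agree k m x x' u = b}"
  proof (rule card_mono)
    show "(\<Union>i\<in>I. S i) \<subseteq> {u \<in> {1..2 * m}. agree k m x x' u = b}"
    proof
      fix u assume "u \<in> (\<Union>i\<in>I. S i)"
      then obtain i where "i \<in> I" "u \<in> S i" by blast
      then show "u \<in> {u \<in> {1..2 * m}. agree k m x x' u = b}"
        using S(1)[of i] S(3)[of i u] range[of u i] by blast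
    qed
  qed simp
  finally show ?thesis .
qed simp

section \<open>Quadratic offsets and nearly coincident jumps\<close>

lemma next_prime_bounds:
  assumes "k \<ge> 1"
  shows "prime (next_prime k)" "k < next_prime k" "next_prime k \<le> 4 * k"
proof -
  obtain p where p: "prime p" "k < p" "p \<le> 4 * k"
    using ex_prime_between_n_4n[OF assms] by blast
  then have "prime (next_prime k) \<and> k < next_prime k"
    unfolding next_prime_def using LeastI[of "\<lambda>p. prime p \<and> k < p" p] by blast
  then show "prime (next_prime k)" "k < next_prime k" by auto
  have "next_prime k \<le> p" unfolding next_prime_def using p by (simp add: Least_le)
  then show "next_prime k \<le> 4 * k" using p by linarith
qed

text \<open>Two jumps can only be close if their indices differ by the integer nearest to
  \<open>\<Delta> = (x' - x) k / m\<close>, and then the differences of quadratic residues \<open>(i + r)\<^sup>2 - i\<^sup>2\<close>,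
  which are distinct modulo \<open>p\<close>, must fall into a short interval.\<close>

lemma card_close_jumps_le:
  assumes k: "2 \<le> k" and xx': "x < x'" "m < 3 * k * (x' - x)" and q: "64 * k * q \<le> m"
    and m: "m > 0"
  defines "M \<equiv> {i. i < k \<and> (\<exists>i'<k. \<bar>real x' + thr k m i - real x - thr k m i'\<bar> < real q)}"
  shows "k \<le> 3 * (k - card M)"
proof (cases "M = {}")
  case True
  then show ?thesis using k by simp
next
  case False
  define p where "p = next_prime k"
  have p: "prime p" "k < p" "p \<le> 4 * k"
    using next_prime_bounds[of k] k by (simp_all add: p_def)
  define \<Delta> where "\<Delta> = (real x' - real x) * real k / real m"
  define r where "r = \<lfloor>\<Delta> + 1 / 2\<rfloor>"
  have k0: "real k > 0" and m0: "real m > 0" using k m by auto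
  \<comment> \<open>This excludes close jumps of equal index, which would need
    \<open>\<Delta> < 1 / 64\<close>; hence \<open>r \<ge> 1\<close> below.\<close>
  have \<Delta>: "\<Delta> > 1 / 3"
  proof -
    have "real m < real (3 * k * (x' - x))" using xx'(2) by (simp only: of_nat_less_iff)
    also have "\<dots> = 3 * ((real x' - real x) * real k)" using xx'(1) by (simp add: of_nat_diff)
    finally show ?thesis using m0 unfolding \<Delta>_def by (simp add: pos_less_divide_eq)
  qed
  \<comment> \<open>Distances are scaled by \<open>k / m\<close>, turning \<open>q\<close> into at
    most 1/64. The offset terms differ by less than 1/3, so \<open>i' - i\<close> is within 1/2 of
    \<open>\<Delta>\<close> and must be its rounding \<open>r\<close>.\<close>
  have close: "1 \<le> r \<and> int i + r < int k \<and>
      \<bar>\<Delta> - real_of_int r - (offset k (i + nat r) - offset k i) / 3\<bar> < 1 / 64" if "i \<in> M" for i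
  proof -
    obtain i' where i': "i' < k" "\<bar>real x' + thr k m i - real x - thr k m i'\<bar> < real q"
      using \<open>i \<in> M\<close> unfolding M_def by blast
    have "\<Delta> + real i - real i' + (offset k i - offset k i') / 3
        = (real x' + thr k m i - real x - thr k m i') * (real k / real m)"
      using k0 m0 by (simp add: \<Delta>_def thr_def field_simps)
    also have "\<bar>\<dots>\<bar> < real q * (real k / real m)"
    proof -
      have "real k / real m > 0" using k0 m0 by simp
      then show ?thesis using mult_strict_right_mono[OF i'(2), of "real k / real m"]
        by (simp only: abs_mult abs_of_pos)
    qed
    also have "\<dots> \<le> 1 / 64"
    proof -
      have "real (64 * k * q) \<le> real m" using q by (simp only: of_nat_le_iff)
      then show ?thesis using m0 by (simp add: field_simps)
    qed
    finally have b: "\<bar>\<Delta> + real i - real i' + (offset k i - offset k i') / 3\<bar> < 1 / 64" .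
    have "real_of_int (int i' - int i) \<le> \<Delta> + 1 / 2" "\<Delta> + 1 / 2 < real_of_int (int i' - int i) + 1"
      using b offset_bounds[of k i] offset_bounds[of k i']
      unfolding of_int_diff of_int_of_nat_eq abs_less_iff by argo+
    then have "r = int i' - int i"
      unfolding r_def by (rule floor_unique)
    moreover have "i \<noteq> i'"
      using b \<Delta> by auto
    moreover have "r \<ge> 0" using \<Delta> by (simp add: r_def)
    ultimately have "r \<ge> 1" "i' = i + nat r" by auto
    moreover have "real i' = real i + real_of_int r"
      using calculation by simp
    ultimately show ?thesis using b i'(1) by (simp add: diff_divide_distrib algebra_simps)
  qed
  have r: "r \<ge> 1" "nat r < p" 
  proof -
    from False obtain i where "i \<in> M" by blast
    from close[OF this] show "r \<ge> 1" "nat r < p" using p(2) by auto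
  qed
  have "M \<subseteq> {..<k - 1}"
  proof
    fix i assume "i \<in> M"
    from close[OF this] show "i \<in> {..<k - 1}" by auto
  qed
  then have c1: "card M \<le> k - 1" using card_mono[of "{..<k - 1}" M] by simp
  \<comment> \<open>The offset difference times \<open>p\<close>: an integer congruent to
    \<open>(i + r)\<^sup>2 - i\<^sup>2\<close> modulo \<open>p\<close>, the floors coming from
    \<open>frac\<close>.\<close>
  define z :: "nat \<Rightarrow> int" where "z i = (int i + r)\<^sup>2 - (int i)\<^sup>2
      - int p * (\<lfloor>real ((i + nat r)\<^sup>2) / real p\<rfloor> - \<lfloor>real (i\<^sup>2) / real p\<rfloor>)" for i
  have p0: "real p > 0" using p by simp
  have z: "real_of_int (z i) = real p * (offset k (i + nat r) - offset k i)" for i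
    using p0 r by (simp add: z_def offset_def frac_def p_def[symmetric] algebra_simps)
  \<comment> \<open>Equal values make \<open>p\<close> divide \<open>2 * r * (i - j)\<close>; here
    \<open>p > 2\<close> is prime, \<open>1 \<le> r < p\<close> and
    \<open>\<bar>i - j\<bar> < p\<close>.\<close>
  have "inj_on z M"
  proof (rule inj_onI)
    fix i j assume ij: "i \<in> M" "j \<in> M" "z i = z j"
    define e where "e = (\<lfloor>real ((i + nat r)\<^sup>2) / real p\<rfloor> - \<lfloor>real (i\<^sup>2) / real p\<rfloor>)
       - (\<lfloor>real ((j + nat r)\<^sup>2) / real p\<rfloor> - \<lfloor>real (j\<^sup>2) / real p\<rfloor>)"
    have "int 2 * (int (nat r) * (int i - int j)) = int p * e"
      using ij(3) r by (simp add: z_def e_def algebra_simps power2_eq_square)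
    then have "int p dvd int 2 * (int (nat r) * (int i - int j))" by simp
    moreover have "prime (int p)" using p by simp
    moreover have "\<not> int p dvd int 2" "\<not> int p dvd int (nat r)"
      using p k r by (auto simp only: int_dvd_int_iff dest!: dvd_imp_le)
    ultimately have "int p dvd int i - int j" by (metis prime_dvd_mult_iff)
    moreover have "\<bar>int i - int j\<bar> < int p" using ij p(2) by (auto simp: M_def)
    ultimately show "i = j" using dvd_imp_le_int[of "int i - int j" "int p"] by auto
  qed
  then have "card M = card (z ` M)" by (simp add: card_image)
  \<comment> \<open>Solving the closeness condition for \<open>z i\<close> gives an open interval of
    length \<open>3 * p / 32\<close> starting at \<open>a\<close>. It contains fewer than
    \<open>3 * p / 32 + 1\<close> integers, and \<open>p \<le> 4 * k\<close> turns this into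
    \<open>3 * k / 8 + 1\<close>.\<close>
  define a where "a = 3 * real p * (\<Delta> - real_of_int r) - 3 * real p / 64"
  define n where "n = \<lceil>a + 3 * real p / 32\<rceil> - 1 - \<lfloor>a\<rfloor>"
  have zM: "z ` M \<subseteq> {\<lfloor>a\<rfloor> + 1..\<lceil>a + 3 * real p / 32\<rceil> - 1}"
  proof
    fix y assume "y \<in> z ` M"
    then obtain i where i: "i \<in> M" "y = z i" by blast
    define u where "u = \<Delta> - real_of_int r - (offset k (i + nat r) - offset k i) / 3"
    have u: "real_of_int (z i) = 3 * real p * (\<Delta> - real_of_int r) - 3 * (real p * u)"
      unfolding z u_def by (simp add: algebra_simps)
    have u64: "u < 1 / 64" "- (1 / 64) < u"
      using close[OF i(1)] unfolding u_def[symmetric] abs_less_iff by auto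
    have "real p * u < real p * (1 / 64)" "real p * (- (1 / 64)) < real p * u"
      by (rule mult_strict_left_mono[OF u64(1) p0], rule mult_strict_left_mono[OF u64(2) p0])
    then have "a < real_of_int (z i)" "real_of_int (z i) < a + 3 * real p / 32"
      unfolding u a_def by argo+
    then have "\<lfloor>a\<rfloor> < z i" "z i < \<lceil>a + 3 * real p / 32\<rceil>"
      by (simp_all only: floor_less_iff less_ceiling_iff)
    then show "y \<in> {\<lfloor>a\<rfloor> + 1..\<lceil>a + 3 * real p / 32\<rceil> - 1}" using i by simp
  qed
  have "card (z ` M) \<le> nat n"
    using card_mono[OF _ zM] by (simp add: n_def)
  moreover have "real_of_int n < 3 * real p / 32 + 1"
    unfolding n_def using ceiling_correct[of "a + 3 * real p / 32"] floor_correct[of a]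
    unfolding of_int_diff of_int_add of_int_1 by argo
  then have "real (nat n) < 3 * real p / 32 + 1"
    using p0 by (cases "n \<ge> 0") (simp_all add: add_pos_pos)
  ultimately have "real (card M) < 3 * real p / 32 + 1"
    using \<open>card M = card (z ` M)\<close> by simp
  moreover have "real p \<le> 4 * real k" using p(3) by simp
  ultimately have "8 * real (card M) < 3 * real k + 8" by argo
  then have "8 * card M < 3 * k + 8" by linarith
  \<comment> \<open>For \<open>k \<le> 3\<close> a single isolated jump suffices, and the last index
    always provides one.\<close>
  moreover have "k \<le> 3 * (k - c)" if "8 * c < 3 * k + 8" "c \<le> k - 1" for c
  proof (cases "k \<le> 3")
    case True
    then show ?thesis using k that(2) by linarith
  next
    case False
    then show ?thesis using that(1) by linarith
  qed
  ultimately show ?thesis using c1 by blast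
qed

text \<open>Up to distance \<open>m / (3 * k)\<close> all \<open>k\<close> jumps are isolated at
  radius \<open>x' - x\<close>. Beyond that, a third of them are isolated at radius about
  \<open>m / (64 * k)\<close>, giving about \<open>m / 192\<close>; rounding costs the rest of the
  constant 250.\<close>

lemma card_agree_ge_aux:
  assumes "2 \<le> k" "300 * k \<le> m" "1 \<le> x" "x < x'" "x' \<le> m"
  shows "min (real k * (real x' - real x)) (real m / 250)
    \<le> real (card {u \<in> {1..2 * m}. agree k m x x' u = b})"
proof (cases "3 * k * (x' - x) \<le> m")
  case True
  \<comment> \<open>Jumps of equal index are exactly \<open>x' - x\<close> apart; for different
    indices the gap is at least twice that, and the shift removes at most \<open>x' - x\<close> of
    it.\<close>
  have iso: "real (x' - x) \<le> \<bar>real x' + thr k m i - real x - thr k m i'\<bar>"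
    if "i \<in> {..<k}" "i' < k" for i i'
  proof -
    have "real (3 * k * (x' - x)) \<le> real m" using True by (simp only: of_nat_le_iff)
    then have "2 * real (x' - x) \<le> 2 * real m / (3 * real k)" using assms(1) by (simp add: field_simps)
    then show ?thesis
      using thr_gap[of i i' k m] thr_gap[of i' i k m] assms(1,4)
      by (cases i i' rule: linorder_cases) (auto simp: of_nat_diff)
  qed
  have "card {..<k} * (x' - x) \<le> card {u \<in> {1..2 * m}. agree k m x x' u = b}"
    using assms True by (intro card_agree_ge_isolated iso) auto
  then have "real (k * (x' - x)) \<le> real (card {u \<in> {1..2 * m}. agree k m x x' u = b})"
    by (simp only: of_nat_le_iff card_lessThan)
  then show ?thesis using assms(4) by (simp add: of_nat_diff)
next
  case False
  define q where "q = m div (64 * k)"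
  define M where "M = {i. i < k \<and> (\<exists>i'<k. \<bar>real x' + thr k m i - real x - thr k m i'\<bar> < real q)}"
  have q: "64 * k * q \<le> m" unfolding q_def by simp
  have M: "M \<subseteq> {..<k}" "k \<le> 3 * (k - card M)"
    using card_close_jumps_le[of k x x' m q] assms False q by (auto simp: M_def)
  have "card ({..<k} - M) = k - card M"
    using M(1) by (subst card_Diff_subset) (auto intro: finite_subset)
  moreover have "card ({..<k} - M) * q \<le> card {u \<in> {1..2 * m}. agree k m x x' u = b}"
  proof (rule card_agree_ge_isolated)
    have "3 * k * q \<le> 3 * k * (x' - x)" using False q by linarith
    then show "x + q \<le> x'" using assms by (simp add: mult_le_cancel1)
    show "3 * k * q \<le> m" using q by linarith
    show "real q \<le> \<bar>real x' + thr k m i - real x - thr k m i'\<bar>" if "i \<in> {..<k} - M" "i' < k" for i i'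
      using that unfolding M_def by (auto simp: not_less dest: spec[of _ i'])
  qed (use assms in auto)
  ultimately have c: "(k - card M) * q \<le> card {u \<in> {1..2 * m}. agree k m x x' u = b}" by simp
  have "m < 64 * k * (q + 1)"
    using assms(1) unfolding q_def by (simp add: dividend_less_times_div)
  then have "m \<le> 64 * (k * q) + 64 * k" by (simp add: algebra_simps)
  moreover have "k * q \<le> 3 * ((k - card M) * q)"
    using mult_le_mono1[OF M(2), of q] by (simp add: mult.assoc)
  ultimately have "m \<le> 192 * card {u \<in> {1..2 * m}. agree k m x x' u = b} + 64 * k"
    using c by linarith
  \<comment> \<open>The factor 1500 clears denominators: \<open>300 * k \<le> m\<close> bounds
    \<open>1500 * 64 * k\<close> by \<open>320 * m\<close>, and
    \<open>1500 * 192 / 1180 < 250\<close>.\<close>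
  then have "1500 * m \<le> 1500 * (192 * card {u \<in> {1..2 * m}. agree k m x x' u = b}) + 320 * m"
    using assms(2) by linarith
  then have "m \<le> 250 * card {u \<in> {1..2 * m}. agree k m x x' u = b}" by linarith
  then have "real m \<le> real (250 * card {u \<in> {1..2 * m}. agree k m x x' u = b})"
    by (simp only: of_nat_le_iff)
  then show ?thesis by simp
qed

lemma card_agree_ge:
  assumes "2 \<le> k" "300 * k \<le> m" "x \<in> {1..m}" "x' \<in> {1..m}"
  shows "min (real k * \<bar>real x - real x'\<bar>) (real m / 250)
    \<le> real (card {u \<in> {1..2 * m}. agree k m x x' u = b})"
proof (cases x x' rule: linorder_cases)
  case less
  then show ?thesis using card_agree_ge_aux[of k m x x' b] assms by simp
next
  case greater
  have "agree k m x x' u = agree k m x' x u" for u by (auto simp: agree_def)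
  then show ?thesis using greater card_agree_ge_aux[of k m x' x b] assms by simp
next
  case equal
  show ?thesis unfolding equal by (rule order_trans[OF min.cobounded1]) simp
qed

section \<open>Distinguishing vertices and counting parts\<close>

text \<open>Grouping the inequalities by coordinate makes adjacency the parity of a sum of
  one-variable functions, so coordinates can be frozen.\<close>

lemma mem_grid_edges_iff:
  "(x, y) \<in> grid_edges d k m \<longleftrightarrow> x \<in> grid d m \<and> y \<in> grid d (2 * m) \<and>
     even (\<Sum>j\<in>{1..d}. level k m (real (y j) - real (x j)))"
proof -
  have "{(i, j). i < k \<and> j \<in> {1..d} \<and> real (y j) - real (x j) - real i * real m / real k
            - offset k i * real m / (3 * real k) \<ge> 0}
      = prod.swap ` (SIGMA j:{1..d}. {i. i < k \<and> thr k m i \<le> real (y j) - real (x j)})"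
    by (force simp: thr_def image_iff)
  also have "card \<dots> = (\<Sum>j\<in>{1..d}. level k m (real (y j) - real (x j)))"
    by (subst card_image) (auto simp: level_def intro: inj_onI)
  finally show ?thesis by (simp add: grid_edges_def)
qed

text \<open>Once the other coordinates are frozen, their parities decide whether agreement or
  disagreement at \<open>j\<close> distinguishes the vertices; hence the one-dimensional bound is
  required for both values of \<open>b\<close>.\<close>

lemma card_distinguishing_ge:
  assumes x: "x \<in> grid d m" "x' \<in> grid d m" and j: "j \<in> {1..d}"
    and B: "\<And>b. B \<le> real (card {u \<in> {1..2 * m}. agree k m (x j) (x' j) u = b})"
  shows "B * (2 * real m) ^ (d - 1)
    \<le> real (card {y \<in> grid d (2 * m). ((x, y) \<in> grid_edges d k m) \<noteq> ((x', y) \<in> grid_edges d k m)})"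
    (is "_ \<le> real (card ?D)")
proof -
  define J where "J = {1..d} - {j}"
  define rest where "rest x z = (\<Sum>l\<in>J. level k m (real (z l) - real (x l)))"
    for x z :: "nat \<Rightarrow> nat"
  define c where "c z \<longleftrightarrow> (even (rest x z) \<longleftrightarrow> even (rest x' z))" for z
  define U where "U z = {u \<in> {1..2 * m}. agree k m (x j) (x' j) u = (\<not> c z)}" for z
  define S where "S = Sigma (J \<rightarrow>\<^sub>E {1..2 * m}) U"
  have finJ: "finite J" and jJ: "j \<notin> J" and insJ: "{1..d} = insert j J"
    using j by (auto simp: J_def)
  have upd: "z(j := u) \<in> ?D" if "z \<in> J \<rightarrow>\<^sub>E {1..2 * m}" "u \<in> U z" for z u
  proof -
    have y: "z(j := u) \<in> grid d (2 * m)"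
      using that unfolding grid_def insJ U_def by (intro PiE_fun_upd) auto
    have "(\<Sum>l\<in>{1..d}. level k m (real ((z(j := u)) l) - real (v l)))
        = level k m (real u - real (v j)) + rest v z" for v :: "nat \<Rightarrow> nat"
    proof -
      have "(\<Sum>l\<in>J. level k m (real ((z(j := u)) l) - real (v l))) = rest v z"
        unfolding rest_def by (rule sum.cong) (use jJ in auto)
      then show ?thesis unfolding insJ using finJ jJ by simp
    qed
    then have "((x, z(j := u)) \<in> grid_edges d k m) \<noteq> ((x', z(j := u)) \<in> grid_edges d k m)"
      using that(2) x y unfolding mem_grid_edges_iff U_def c_def agree_def by auto
    with y show ?thesis by simp
  qed
  have inj: "inj_on (\<lambda>(z, u). z(j := u)) S"
  proof (rule inj_onI, clarsimp simp: S_def)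
    fix z u z' u'
    assume z: "z \<in> J \<rightarrow>\<^sub>E {Suc 0..2 * m}" "z' \<in> J \<rightarrow>\<^sub>E {Suc 0..2 * m}"
      and eq: "z(j := u) = z'(j := u')"
    \<comment> \<open>Both take the default value \<open>undefined\<close> at \<open>j\<close>, so
      overwriting that coordinate loses nothing.\<close>
    have "z j = z' j" using z jJ by (metis PiE_arb)
    then show "z = z' \<and> u = u'" using eq by (metis fun_upd_eqD fun_upd_triv fun_upd_upd)
  qed
  have finS: "finite (J \<rightarrow>\<^sub>E {1..2 * m})" using finJ by (intro finite_PiE) auto
  have "card (J \<rightarrow>\<^sub>E {1..2 * m}) = (2 * m) ^ (d - 1)"
    using finJ j by (simp add: card_PiE) (simp add: J_def)
  then have "B * (2 * real m) ^ (d - 1) = (\<Sum>z\<in>J \<rightarrow>\<^sub>E {1..2 * m}. B)"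
    by (simp add: mult.commute)
  also have "\<dots> \<le> (\<Sum>z\<in>J \<rightarrow>\<^sub>E {1..2 * m}. real (card (U z)))"
    unfolding U_def by (intro sum_mono B)
  also have "\<dots> = real (card S)"
    unfolding S_def using finS by (subst card_SigmaI) (auto simp: U_def)
  also have "card S = card ((\<lambda>(z, u). z(j := u)) ` S)" using inj by (simp add: card_image)
  also have "\<dots> \<le> card ?D"
    by (intro card_mono) (use upd in \<open>auto simp: S_def grid_def intro!: finite_PiE\<close>)
  finally show ?thesis by simp
qed

section \<open>Part sizes and averaging over parts\<close>

lemma card_le_of_coordinate_diameter:
  fixes A :: "(nat \<Rightarrow> nat) set"
  assumes "A \<subseteq> {1..d} \<rightarrow>\<^sub>E X" "finite A" "0 \<le> R"
    and diam: "\<And>x x' j. x \<in> A \<Longrightarrow> x' \<in> A \<Longrightarrow> j \<in> {1..d} \<Longrightarrow> \<bar>real (x j) - real (x' j)\<bar> \<le> R"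
  shows "real (card A) \<le> (R + 1) ^ d"
proof (cases "A = {}")
  case False
  \<comment> \<open>The coordinatewise minima form the lower corner of a box containing
    \<open>A\<close>.\<close>
  define l where "l j = Min ((\<lambda>x. x j) ` A)" for j :: nat
  have box: "x j \<in> {l j..l j + nat \<lfloor>R\<rfloor>}" if "x \<in> A" "j \<in> {1..d}" for x j
  proof -
    have "l j \<in> (\<lambda>x. x j) ` A" unfolding l_def using assms(2) False by (intro Min_in) auto
    then obtain x' where x': "x' \<in> A" "l j = x' j" by blast
    have "l j \<le> x j" unfolding l_def using assms(2) that by (intro Min_le) auto
    moreover have "real (x j) - real (l j) \<le> R" using diam[OF that(1) x'(1) that(2)] x' by simp
    then have "int (x j) - int (l j) \<le> \<lfloor>R\<rfloor>" by (simp add: le_floor_iff)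
    then have "x j \<le> l j + nat \<lfloor>R\<rfloor>" by linarith
    ultimately show ?thesis unfolding atLeastAtMost_iff by blast
  qed
  have "A \<subseteq> (\<Pi>\<^sub>E j\<in>{1..d}. {l j..l j + nat \<lfloor>R\<rfloor>})"
  proof
    fix x assume "x \<in> A"
    moreover from this have "x \<in> extensional {1..d}" using assms(1) unfolding PiE_def by blast
    ultimately show "x \<in> (\<Pi>\<^sub>E j\<in>{1..d}. {l j..l j + nat \<lfloor>R\<rfloor>})"
      unfolding PiE_iff using box by blast
  qed
  then have "card A \<le> card (\<Pi>\<^sub>E j\<in>{1..d}. {l j..l j + nat \<lfloor>R\<rfloor>})"
    by (intro card_mono finite_PiE) auto
  also have "\<dots> = (nat \<lfloor>R\<rfloor> + 1) ^ d" by (simp add: card_PiE)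
  finally have "real (card A) \<le> (real (nat \<lfloor>R\<rfloor>) + 1) ^ d"
    by (metis of_nat_1 of_nat_add of_nat_le_iff of_nat_power)
  also have "\<dots> \<le> (R + 1) ^ d" using assms(3) by (intro power_mono) auto
  finally show ?thesis .
qed (use assms(3) in simp)

text \<open>Summed over all parts, this bound replaces an application of the power mean inequality.\<close>

lemma mult_diff_le_power:
  fixes w l s :: real
  assumes "0 \<le> w" "w \<le> l ^ d" "0 \<le> l" "0 \<le> s" "1 \<le> d"
  shows "w * (s - l) \<le> s * s ^ d / 4"
proof (cases "l \<ge> s")
  case True
  then have "w * (s - l) \<le> 0" using assms by (intro mult_nonneg_nonpos) auto
  also have "\<dots> \<le> s * s ^ d / 4" using assms by simp
  finally show ?thesis .
next
  case False
  obtain d' where d: "d = Suc d'" using assms(5) by (cases d) auto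
  have "w * (s - l) \<le> l ^ d * (s - l)" using assms False by (intro mult_right_mono) auto
  also have "\<dots> = l ^ d' * (l * (s - l))" by (simp add: d)
  also have "\<dots> \<le> s ^ d' * (s\<^sup>2 / 4)"
  proof (rule mult_mono)
    have "0 \<le> (s - 2 * l)\<^sup>2" by simp
    then show "l * (s - l) \<le> s\<^sup>2 / 4" by (simp add: power2_eq_square algebra_simps)
  qed (use assms False in \<open>auto intro: power_mono\<close>)
  also have "\<dots> = s * s ^ d / 4" by (simp add: d power2_eq_square)
  finally show ?thesis .
qed

text \<open>By Markov's inequality the parts with \<open>e A < \<eta>\<close> carry at least half
  the weight. Summing \<open>mult_diff_le_power\<close> over these at most \<open>1 / s ^ d\<close>
  parts, with \<open>l = \<alpha> * e A + \<beta>\<close>, gives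
  \<open>s / 2 \<le> s / 4 + \<alpha> * \<epsilon> + \<beta>\<close>.\<close>

lemma weighted_error_lower_bound:
  fixes w e :: "'a \<Rightarrow> real"
  assumes "finite P" and w: "\<And>A. A \<in> P \<Longrightarrow> 0 \<le> w A" "(\<Sum>A\<in>P. w A) = 1"
    and e: "\<And>A. A \<in> P \<Longrightarrow> 0 \<le> e A" "(\<Sum>A\<in>P. w A * e A) \<le> \<epsilon>" and \<epsilon>: "2 * \<epsilon> \<le> \<eta>" "0 < \<eta>"
    and we: "\<And>A. A \<in> P \<Longrightarrow> e A < \<eta> \<Longrightarrow> w A \<le> (\<alpha> * e A + \<beta>) ^ d"
    and pos: "0 \<le> \<alpha>" "0 \<le> \<beta>" "0 < s" "1 \<le> d"
    and card: "real (card P) * s ^ d \<le> 1"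
  shows "s / 4 \<le> \<alpha> * \<epsilon> + \<beta>"
proof -
  define G where "G = {A \<in> P. e A < \<eta>}"
  have G: "finite G" "G \<subseteq> P" using assms(1) by (auto simp: G_def)
  have "\<eta> * (\<Sum>A\<in>P - G. w A) \<le> (\<Sum>A\<in>P - G. w A * e A)"
    unfolding sum_distrib_left
  proof (rule sum_mono)
    fix A assume "A \<in> P - G"
    then have "\<eta> \<le> e A" "0 \<le> w A" using w(1) by (auto simp: G_def)
    then show "\<eta> * w A \<le> w A * e A" using mult_left_mono[of \<eta> "e A" "w A"] by (simp only: mult.commute)
  qed
  also have "\<dots> \<le> (\<Sum>A\<in>P. w A * e A)"
    using assms(1) w(1) e(1) by (intro sum_mono2) auto
  also have "\<dots> \<le> \<eta> * (1 / 2)" using e(2) \<epsilon> by simp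
  finally have "(\<Sum>A\<in>P - G. w A) \<le> 1 / 2" using \<epsilon>(2) by (simp only: mult_le_cancel_left_pos)
  moreover have "(\<Sum>A\<in>P. w A) = (\<Sum>A\<in>P - G. w A) + (\<Sum>A\<in>G. w A)"
    by (rule sum.subset_diff) (use assms(1) G in auto)
  ultimately have W: "1 / 2 \<le> (\<Sum>A\<in>G. w A)" using w(2) by linarith
  have "s * (1 / 2) \<le> s * (\<Sum>A\<in>G. w A)" using W pos by (intro mult_left_mono) auto
  also have "\<dots> = (\<Sum>A\<in>G. w A * (s - (\<alpha> * e A + \<beta>))) + (\<alpha> * (\<Sum>A\<in>G. w A * e A) + \<beta> * (\<Sum>A\<in>G. w A))"
    unfolding sum_distrib_left sum.distrib[symmetric] by (rule sum.cong) (simp_all add: algebra_simps)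
  also have "\<dots> \<le> s / 4 + (\<alpha> * \<epsilon> + \<beta> * 1)"
  proof (intro add_mono mult_left_mono)
    have "(\<Sum>A\<in>G. w A * (s - (\<alpha> * e A + \<beta>))) \<le> (\<Sum>A\<in>G. s * s ^ d / 4)"
      using w(1) e(1) we pos by (intro sum_mono mult_diff_le_power) (auto simp: G_def)
    also have "\<dots> = s / 4 * (real (card G) * s ^ d)" by simp
    also have "\<dots> \<le> s / 4 * 1"
    proof (rule mult_left_mono)
      have "real (card G) * s ^ d \<le> real (card P) * s ^ d"
        using card_mono[OF assms(1) G(2)] pos by (intro mult_right_mono) auto
      then show "real (card G) * s ^ d \<le> 1" using card by linarith
    qed (use pos in simp)
    finally show "(\<Sum>A\<in>G. w A * (s - (\<alpha> * e A + \<beta>))) \<le> s / 4" by simp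
    have "(\<Sum>A\<in>G. w A * e A) \<le> (\<Sum>A\<in>P. w A * e A)"
      using assms(1) G w(1) e(1) by (intro sum_mono2) auto
    then show "(\<Sum>A\<in>G. w A * e A) \<le> \<epsilon>" using e(2) by linarith
    show "(\<Sum>A\<in>G. w A) \<le> 1" unfolding w(2)[symmetric]
      using assms(1) G w(1) by (intro sum_mono2) auto
  qed (use pos in auto)
  finally show ?thesis by simp
qed

lemma card_eq_sum_parts:
  assumes "partition_on P Q" "finite P"
  shows "card P = (\<Sum>A\<in>Q. card A)"
proof -
  have "finite A" if "A \<in> Q" for A
    using assms that by (auto dest!: partition_onD1 intro: finite_subset)
  moreover have "disjoint Q" by (rule partition_onD2[OF assms(1)])
  ultimately have "card (\<Union>Q) = (\<Sum>A\<in>Q. card A)"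
    by (intro card_Union_disjoint) (auto simp: disjoint_def pairwise_def disjnt_def)
  then show ?thesis using partition_onD1[OF assms(1)] by simp
qed

lemma card_distinguishing_le_mixed:
  assumes "partition_on P2 \<Pi>2" "finite P2" "x \<in> A" "x' \<in> A"
  shows "card {y \<in> P2. ((x, y) \<in> E) \<noteq> ((x', y) \<in> E)} \<le> (\<Sum>B\<in>{B \<in> \<Pi>2. mixed_pair E A B}. card B)"
proof -
  have fin: "finite \<Pi>2" by (rule finite_elements[OF assms(2,1)])
  have P2: "P2 = \<Union>\<Pi>2" by (rule partition_onD1[OF assms(1)])
  have "{y \<in> P2. ((x, y) \<in> E) \<noteq> ((x', y) \<in> E)} \<subseteq> \<Union>{B \<in> \<Pi>2. mixed_pair E A B}"
  proof
    fix y assume y: "y \<in> {y \<in> P2. ((x, y) \<in> E) \<noteq> ((x', y) \<in> E)}"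
    then obtain B where B: "B \<in> \<Pi>2" "y \<in> B" using P2 by blast
    have "mixed_pair E A B" unfolding mixed_pair_def using y B(2) assms(3,4) by blast
    then show "y \<in> \<Union>{B \<in> \<Pi>2. mixed_pair E A B}" using B by blast
  qed
  then have "card {y \<in> P2. ((x, y) \<in> E) \<noteq> ((x', y) \<in> E)} \<le> card (\<Union>{B \<in> \<Pi>2. mixed_pair E A B})"
    by (rule card_mono[rotated]) (use assms(2) P2 in \<open>auto intro: finite_subset\<close>)
  also have "\<dots> \<le> (\<Sum>B\<in>{B \<in> \<Pi>2. mixed_pair E A B}. card B)"
    by (rule card_Union_le_sum_card)
  finally show ?thesis .
qed

text \<open>Here \<open>e\<close> is the fraction of the second class lying in parts mixed with
  \<open>A\<close>. It bounds the fraction of distinguishing vertices, and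
  \<open>e < 1 / 500\<close> rules out the term \<open>m / 250\<close> of the minimum, leaving a
  bound on the coordinate distance.\<close>

lemma card_part_le:
  assumes k: "2 \<le> k" and m: "300 * k \<le> m" and d: "1 \<le> d"
    and \<Pi>2: "partition_on (grid d (2 * m)) \<Pi>2" and A: "A \<subseteq> grid d m"
  defines "e \<equiv> (\<Sum>B\<in>{B \<in> \<Pi>2. mixed_pair (grid_edges d k m) A B}. real (card B)) / (2 * real m) ^ d"
  assumes e: "e < 1 / 500"
  shows "real (card A) \<le> (2 * real m * e / real k + 1) ^ d"
proof (rule card_le_of_coordinate_diameter)
  have m0: "real m > 0" using k m by linarith
  have fin: "finite (grid d n)" for n unfolding grid_def by (intro finite_PiE) auto
  show "A \<subseteq> {1..d} \<rightarrow>\<^sub>E {1..m}" using A by (simp add: grid_def)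
  show "finite A" using A fin finite_subset by blast
  show "0 \<le> 2 * real m * e / real k" unfolding e_def by (simp add: sum_nonneg)
  fix x x' j assume xx': "x \<in> A" "x' \<in> A" and j: "j \<in> {1..d}"
  define B where "B = min (real k * \<bar>real (x j) - real (x' j)\<bar>) (real m / 250)"
  have g: "x \<in> grid d m" "x' \<in> grid d m" using xx' A by auto
  then have "x j \<in> {1..m}" "x' j \<in> {1..m}" using j unfolding grid_def by (blast dest: PiE_mem)+
  then have "B * (2 * real m) ^ (d - 1)
      \<le> real (card {y \<in> grid d (2 * m). ((x, y) \<in> grid_edges d k m) \<noteq> ((x', y) \<in> grid_edges d k m)})"
    unfolding B_def by (intro card_distinguishing_ge[OF g j] card_agree_ge k m)
  also have "\<dots> \<le> real (\<Sum>B\<in>{B \<in> \<Pi>2. mixed_pair (grid_edges d k m) A B}. card B)"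
    by (rule of_nat_mono) (rule card_distinguishing_le_mixed[OF \<Pi>2 fin xx'])
  also have "\<dots> = e * (2 * real m) ^ d" unfolding e_def using m0 by simp
  also have "\<dots> = (2 * real m * e) * (2 * real m) ^ (d - 1)"
    using d by (cases d) (simp_all add: algebra_simps)
  finally have "B \<le> 2 * real m * e" by (rule mult_right_le_imp_le) (use m0 in simp)
  moreover have "2 * real m * e < real m / 250"
    using mult_strict_left_mono[OF e, of "2 * real m"] m0 by simp
  ultimately have "real k * \<bar>real (x j) - real (x' j)\<bar> \<le> 2 * real m * e"
    unfolding B_def by linarith
  then show "\<bar>real (x j) - real (x' j)\<bar> \<le> 2 * real m * e / real k"
    using k by (simp add: pos_le_divide_eq mult.commute)
qed

theorem proposition7p6:
  fixes d D :: nat and \<epsilon> :: real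
  assumes "d \<ge> 1" and "D \<ge> 2 * d" and "0 < \<epsilon>" and "\<epsilon> < 1 / 1000"
  shows "\<exists>m0 :: nat. \<forall>m \<ge> m0. \<forall>\<Pi>1 \<Pi>2.
    homogeneous_partition (grid d m) (grid d (2 * m)) (grid_edges d (D div d) m) \<epsilon> \<Pi>1 \<Pi>2 \<longrightarrow>
    has_at_least_parts \<Pi>1 \<Pi>2 ((real D / (32 * \<epsilon> * real d)) ^ d)"
proof -
  define k where "k = D div d"
  have k: "2 \<le> k" unfolding k_def using assms(1,2) by (simp add: less_eq_div_iff_mult_less_eq)
  \<comment> \<open>Rounding \<open>D / d\<close> down to \<open>k\<close> costs a factor below 3/2,
    as \<open>k \<ge> 2\<close>.\<close>
  have "D < (k + 1) * d"
    unfolding k_def using assms(1) dividend_less_div_times[of d D] by (simp add: algebra_simps)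
  then have "real D < (real k + 1) * real d"
    by (metis of_nat_1 of_nat_add of_nat_less_iff of_nat_mult)
  also have "\<dots> \<le> (3 / 2 * real k) * real d" using k by (intro mult_right_mono) auto
  finally have D: "real D < 3 / 2 * real k * real d" .
  have D0: "real D > 0" "real d > 0" using assms(1,2) by auto
  \<comment> \<open>The reciprocal of the base in the claimed bound: too few parts means
    \<open>card \<Pi>1 * s ^ d \<le> 1\<close>.\<close>
  define s where "s = 32 * \<epsilon> * real d / real D"
  have s: "s > 0" using D0 assms(3) by (simp add: s_def)
  have s_gt: "s > 64 / 3 * \<epsilon> / real k"
  proof -
    have "\<epsilon> * real D < \<epsilon> * (3 / 2 * real k * real d)" by (rule mult_strict_left_mono[OF D assms(3)])
    then show ?thesis using D0 k by (simp add: s_def field_simps)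
  qed
  \<comment> \<open>The first entry serves the one-dimensional estimate; the second makes the
    rounding term \<open>1 / m\<close> at most \<open>\<epsilon> / k\<close>.\<close>
  define m0 where "m0 = max (300 * k) (nat \<lceil>real k / \<epsilon>\<rceil>)"
  show ?thesis
  proof (intro exI[of _ m0] allI impI)
    fix m \<Pi>1 \<Pi>2
    assume m0: "m0 \<le> m" and hom: "homogeneous_partition (grid d m) (grid d (2 * m))
      (grid_edges d (D div d) m) \<epsilon> \<Pi>1 \<Pi>2"
    have m: "300 * k \<le> m" using m0 by (simp add: m0_def)
    have "real k / \<epsilon> \<le> real m" using m0 by (simp add: m0_def nat_le_iff ceiling_le_iff)
    moreover have mpos: "real m > 0" using k m by linarith
    ultimately have m_inv: "1 / real m \<le> \<epsilon> / real k"
      using k assms(3) by (simp add: field_simps)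
    define E where "E = grid_edges d k m"
    define w where "w A = real (card A) / real m ^ d" for A :: "(nat \<Rightarrow> nat) set"
    define e where "e A = (\<Sum>B\<in>{B \<in> \<Pi>2. mixed_pair E A B}. real (card B)) / (2 * real m) ^ d"
      for A :: "(nat \<Rightarrow> nat) set"
    have fin: "finite (grid d n)" for n unfolding grid_def by (intro finite_PiE) auto
    have cg: "card (grid d n) = n ^ d" for n by (simp add: grid_def card_PiE)
    have parts: "partition_on (grid d m) \<Pi>1" "partition_on (grid d (2 * m)) \<Pi>2"
      using hom by (auto simp: homogeneous_partition_def)
    have finP: "finite \<Pi>1" "finite \<Pi>2" using parts fin finite_elements by blast+
    \<comment> \<open>The mixed fractions \<open>e A\<close>, weighted by the relative sizes
      \<open>w A\<close>, sum exactly to the error of the homogeneous partition.\<close>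
    have "(\<Sum>A\<in>\<Pi>1. w A * e A) = (\<Sum>A\<in>\<Pi>1. \<Sum>B\<in>{B \<in> \<Pi>2. mixed_pair E A B}.
        (real (card A) * real (card B)) / (real m ^ d * (2 * real m) ^ d))"
      by (intro sum.cong refl) (simp add: w_def e_def sum_distrib_left sum_divide_distrib)
    also have "\<dots> = (\<Sum>(A, B)\<in>Sigma \<Pi>1 (\<lambda>A. {B \<in> \<Pi>2. mixed_pair E A B}).
        (real (card A) * real (card B)) / (real m ^ d * (2 * real m) ^ d))"
      using finP by (intro sum.Sigma) auto
    also have "Sigma \<Pi>1 (\<lambda>A. {B \<in> \<Pi>2. mixed_pair E A B})
        = {(A, B). A \<in> \<Pi>1 \<and> B \<in> \<Pi>2 \<and> mixed_pair E A B}"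
      by auto
    finally have we: "(\<Sum>A\<in>\<Pi>1. w A * e A) \<le> \<epsilon>"
      using hom by (simp add: homogeneous_partition_def cg E_def k_def)
    have w1: "(\<Sum>A\<in>\<Pi>1. w A) = 1"
    proof -
      have "m ^ d = (\<Sum>A\<in>\<Pi>1. card A)"
        using card_eq_sum_parts[OF parts(1) fin] by (simp only: cg)
      then have "real m ^ d = real (\<Sum>A\<in>\<Pi>1. card A)" by (metis of_nat_power)
      then have "(\<Sum>A\<in>\<Pi>1. real (card A)) = real m ^ d" by simp
      then show ?thesis using mpos by (simp add: w_def flip: sum_divide_distrib)
    qed
    \<comment> \<open>Dividing by \<open>m ^ d\<close> rescales the side
      \<open>2 * m * e A / k + 1\<close>, so \<open>\<alpha> = 2 / k\<close> and
      \<open>\<beta> = 1 / m\<close>.\<close>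
    have small: "w A \<le> (2 / real k * e A + 1 / real m) ^ d" if "A \<in> \<Pi>1" "e A < 1 / 500" for A
    proof -
      have "A \<subseteq> grid d m" using parts(1) that(1) by (auto dest: partition_onD1)
      then have "real (card A) \<le> (2 * real m * e A / real k + 1) ^ d"
        using card_part_le[OF k m assms(1) parts(2), of A] that(2) by (simp add: e_def E_def)
      also have "2 * real m * e A / real k + 1 = (2 / real k * e A + 1 / real m) * real m"
        using mpos by (simp add: field_simps)
      finally show ?thesis using mpos by (simp add: w_def power_mult_distrib pos_divide_le_eq)
    qed
    show "has_at_least_parts \<Pi>1 \<Pi>2 ((real D / (32 * \<epsilon> * real d)) ^ d)"
    proof (rule ccontr)
      assume "\<not> ?thesis"
      then have "real (card \<Pi>1) < (1 / s) ^ d"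
        by (simp add: has_at_least_parts_def s_def)
      then have "real (card \<Pi>1) * s ^ d \<le> 1"
        using s by (simp add: power_divide field_simps)
      then have "s / 4 \<le> 2 / real k * \<epsilon> + 1 / real m"
        using assms s mpos finP we w1 small
        by (intro weighted_error_lower_bound[of \<Pi>1 w e \<epsilon> "1 / 500" _ _ d])
           (auto simp: w_def e_def intro!: divide_nonneg_nonneg sum_nonneg)
      also have "\<dots> \<le> 3 * (\<epsilon> / real k)" using m_inv by simp
      \<comment> \<open>By \<open>s_gt\<close>, \<open>s / 4\<close> exceeds
        \<open>16 / 3 * \<epsilon> / k\<close>.\<close>
      also have "\<dots> < s / 4"
      proof -
        have "\<epsilon> / real k > 0" using assms(3) k by simp
        then show ?thesis using s_gt by simp
      qed
      finally show False by simp
    qed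
  qed
qed

end
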